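(* Let $X$ be a locally bounded topological group and let $\mathrm{Aut}(X)$ be the group of its bicontinuous group automorphisms. Then the conjugation morphism $\gamma : X \to \mathrm{Aut}(X)$, $\gamma(x)(y) = xyx^{-1}$, is continuous if $\mathrm{Aut}(X)$ is endowed with the lower topology.
   Context: A subset $B$ of a topological group $X$ is bounded if for every increasing sequence $V_1 \subseteq V_2 \subseteq \dots$ of open subsets of $X$ with $\bigcup_n V_n = X$ and $V_n^2 \subseteq V_{n+1}$ for all $n$, there is an index $k$ with $B \subseteq V_k$. The group $X$ is locally bounded if it admits a bounded identity neighborhood. The lower (Roelcke) uniform structure of $X$ is generated by the entourages $\{(x,y) \mid x \in VyV\}$, where $V$ runs among identity neighborhoods. For $X$ locally bounded, the lower topology on $\mathrm{Aut}(X)$ is the topology of uniform biconvergence on bounded sets with respect to the lower uniform structure of $X$: a net $(g_i)$ converges to $g$ if and only if both $g_i \to g$ and $g_i^{-1} \to g^{-1}$ uniformly on each bounded subset of $X$, with respect to the lower uniform structure. It makes $\mathrm{Aut}(X)$ a topological group. *)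

theory Defs
  imports "HOL-Analysis.Analysis"
begin

text \<open>
  Topological groups are types of class \<^class>\<open>topological_group_add\<close>. The group is written
  additively but need not be commutative (\<^class>\<open>group_add\<close> has no commutativity axiom), nor is it
  assumed to be Hausdorff. Thus \<open>x + y\<close>, \<open>0\<close>, \<open>- x\<close> stand for the product, the identity and the
  inverse, and \<open>x + y - x\<close> for the conjugate \<open>x y x\<^sup>-\<^sup>1\<close>.
\<close>

definition identity_nbhd :: "'a::topological_group_add set \<Rightarrow> bool" where
  "identity_nbhd V \<longleftrightarrow> 0 \<in> interior V"

definition group_bounded :: "'a::topological_group_add set \<Rightarrow> bool" where
  "group_bounded B \<longleftrightarrow>
     (\<forall>V :: nat \<Rightarrow> 'a set.
        (\<forall>n. open (V n)) \<longrightarrow>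
        (\<forall>n. V n \<subseteq> V (Suc n)) \<longrightarrow>
        (\<Union>n. V n) = UNIV \<longrightarrow>
        (\<forall>n. {x + y | x y. x \<in> V n \<and> y \<in> V n} \<subseteq> V (Suc n)) \<longrightarrow>
        (\<exists>k. B \<subseteq> V k))"

definition locally_bounded_group :: "'a::topological_group_add itself \<Rightarrow> bool" where
  "locally_bounded_group _ \<longleftrightarrow> (\<exists>B :: 'a set. identity_nbhd B \<and> group_bounded B)"

definition lower_entourage :: "'a::topological_group_add set \<Rightarrow> ('a \<times> 'a) set" where
  "lower_entourage V = {(x, y). x \<in> {v + y + w | v w. v \<in> V \<and> w \<in> V}}"

definition Aut :: "('a::topological_group_add \<Rightarrow> 'a) set" where
  "Aut = {g. bij g \<and> (\<forall>x y. g (x + y) = g x + g y) \<and>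
             continuous_on UNIV g \<and> continuous_on UNIV (inv g)}"

definition conjugation :: "'a::topological_group_add \<Rightarrow> 'a \<Rightarrow> 'a" where
  "conjugation x y = x + y - x"

definition biconv_nbhd ::
    "('a::topological_group_add \<Rightarrow> 'a) \<Rightarrow> 'a set \<Rightarrow> 'a set \<Rightarrow> ('a \<Rightarrow> 'a) set" where
  "biconv_nbhd g B V =
     {h \<in> Aut. \<forall>b\<in>B. (h b, g b) \<in> lower_entourage V \<and> (inv h b, inv g b) \<in> lower_entourage V}"

text \<open>
  The sets \<open>biconv_nbhd g B V\<close> are to be the basic neighbourhoods of \<open>g\<close>. The lemma
  \<open>limitin_lower_topology\<close> below shows that this is the topology of uniform biconvergence on
  bounded sets.
\<close>

definition lower_topology :: "('a::topological_group_add \<Rightarrow> 'a) topology" where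
  "lower_topology = topology (\<lambda>U. U \<subseteq> Aut \<and>
     (\<forall>g\<in>U. \<exists>B V. group_bounded B \<and> identity_nbhd V \<and> biconv_nbhd g B V \<subseteq> U))"

lemma group_bounded_empty: "group_bounded {}"
  by (simp add: group_bounded_def)

lemma group_bounded_Un:
  assumes "group_bounded B" "group_bounded C"
  shows "group_bounded (B \<union> C)"
  unfolding group_bounded_def
proof (intro allI impI)
  fix V :: "nat \<Rightarrow> 'a set"
  assume V: "\<forall>n. open (V n)" "\<forall>n. V n \<subseteq> V (Suc n)" "(\<Union>n. V n) = UNIV"
    "\<forall>n. {x + y | x y. x \<in> V n \<and> y \<in> V n} \<subseteq> V (Suc n)"
  obtain k where k: "B \<subseteq> V k"
    using assms(1) V unfolding group_bounded_def by blast
  obtain l where l: "C \<subseteq> V l"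
    using assms(2) V unfolding group_bounded_def by blast
  have mono: "V i \<subseteq> V j" if "i \<le> j" for i j
    using lift_Suc_mono_le[of V i j] V(2) that by blast
  have "B \<union> C \<subseteq> V (max k l)"
    using k l mono[of k "max k l"] mono[of l "max k l"] by auto
  then show "\<exists>k. B \<union> C \<subseteq> V k" ..
qed

lemma identity_nbhd_Int:
  "identity_nbhd V \<Longrightarrow> identity_nbhd W \<Longrightarrow> identity_nbhd (V \<inter> W)"
  by (simp add: identity_nbhd_def)

lemma identity_nbhd_UNIV: "identity_nbhd UNIV"
  by (simp add: identity_nbhd_def)

lemma identity_nbhd_half:
  assumes "identity_nbhd (V :: 'a::topological_group_add set)"
  obtains W where "identity_nbhd W" "\<And>x y. x \<in> W \<Longrightarrow> y \<in> W \<Longrightarrow> x + y \<in> V"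
proof -
  have "((\<lambda>p::'a \<times> 'a. fst p + snd p) \<longlongrightarrow> 0 + 0) (nhds 0 \<times>\<^sub>F nhds 0)"
    by (intro tendsto_add tendsto_fst tendsto_snd filterlim_fst filterlim_snd)
  moreover have "open (interior V)" "0 + 0 \<in> interior V"
    using assms by (auto simp: identity_nbhd_def)
  ultimately have "\<forall>\<^sub>F p in nhds (0::'a) \<times>\<^sub>F nhds 0. fst p + snd p \<in> interior V"
    by (rule topological_tendstoD)
  then obtain P Q where "eventually P (nhds (0::'a))" "eventually Q (nhds (0::'a))"
    and PQ: "\<And>x y. P x \<Longrightarrow> Q y \<Longrightarrow> x + y \<in> interior V"
    unfolding eventually_prod_filter by auto
  then obtain S T where S: "open S" "0 \<in> S" "\<And>x. x \<in> S \<Longrightarrow> P x"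
    and T: "open T" "0 \<in> T" "\<And>x. x \<in> T \<Longrightarrow> Q x"
    unfolding eventually_nhds by metis
  show ?thesis
  proof
    show "identity_nbhd (S \<inter> T)"
      using S T by (simp add: identity_nbhd_def interior_open)
    show "x + y \<in> V" if "x \<in> S \<inter> T" "y \<in> S \<inter> T" for x y
      using PQ[of x y] S(3) T(3) that interior_subset by blast
  qed
qed

lemma lower_entourage_refl: "identity_nbhd V \<Longrightarrow> (x, x) \<in> lower_entourage V"
proof -
  assume "identity_nbhd V"
  then have "0 \<in> V"
    using interior_subset by (auto simp: identity_nbhd_def)
  moreover have "x = 0 + x + 0"
    by simp
  ultimately show ?thesis
    unfolding lower_entourage_def by blast
qed

lemma lower_entourage_mono: "V \<subseteq> W \<Longrightarrow> lower_entourage V \<subseteq> lower_entourage W"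
  unfolding lower_entourage_def by blast

lemma lower_entourage_trans:
  assumes W: "\<And>x y. x \<in> W \<Longrightarrow> y \<in> W \<Longrightarrow> x + y \<in> V"
    and "(x, y) \<in> lower_entourage W" "(y, z) \<in> lower_entourage W"
  shows "(x, z) \<in> lower_entourage V"
proof -
  obtain a b c d where "x = a + y + b" "y = c + z + d" "a \<in> W" "b \<in> W" "c \<in> W" "d \<in> W"
    using assms(2,3) unfolding lower_entourage_def by blast
  then have "x = (a + c) + z + (d + b)" "a + c \<in> V" "d + b \<in> V"
    by (auto simp: add.assoc W)
  then show ?thesis
    unfolding lower_entourage_def by blast
qed

lemma biconv_nbhd_self: "g \<in> Aut \<Longrightarrow> identity_nbhd V \<Longrightarrow> g \<in> biconv_nbhd g B V"
  by (simp add: biconv_nbhd_def lower_entourage_refl)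

lemma biconv_nbhd_Int_supset:
  "biconv_nbhd g (B \<union> C) (V \<inter> W) \<subseteq> biconv_nbhd g B V \<inter> biconv_nbhd g C W"
  using lower_entourage_mono[of "V \<inter> W" V] lower_entourage_mono[of "V \<inter> W" W]
  unfolding biconv_nbhd_def by blast

lemma istopology_lower:
  "istopology (\<lambda>U. U \<subseteq> (Aut :: ('a::topological_group_add \<Rightarrow> 'a) set) \<and>
     (\<forall>g\<in>U. \<exists>B V. group_bounded B \<and> identity_nbhd V \<and> biconv_nbhd g B V \<subseteq> U))"
  unfolding istopology_def
proof (intro conjI allI impI ballI)
  fix S T :: "('a \<Rightarrow> 'a) set" and g
  assume S: "S \<subseteq> Aut \<and> (\<forall>g\<in>S. \<exists>B V. group_bounded B \<and> identity_nbhd V \<and> biconv_nbhd g B V \<subseteq> S)"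
    and T: "T \<subseteq> Aut \<and> (\<forall>g\<in>T. \<exists>B V. group_bounded B \<and> identity_nbhd V \<and> biconv_nbhd g B V \<subseteq> T)"
    and g: "g \<in> S \<inter> T"
  obtain B V where 1: "group_bounded B" "identity_nbhd V" "biconv_nbhd g B V \<subseteq> S"
    using S g by blast
  obtain C W where 2: "group_bounded C" "identity_nbhd W" "biconv_nbhd g C W \<subseteq> T"
    using T g by blast
  have "group_bounded (B \<union> C)" "identity_nbhd (V \<inter> W)"
    using 1 2 by (simp_all add: group_bounded_Un identity_nbhd_Int)
  moreover have "biconv_nbhd g (B \<union> C) (V \<inter> W) \<subseteq> S \<inter> T"
    using biconv_nbhd_Int_supset[of g B C V W] 1 2 by blast
  ultimately show "\<exists>B V. group_bounded B \<and> identity_nbhd V \<and> biconv_nbhd g B V \<subseteq> S \<inter> T"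
    by blast
next
  fix \<K> :: "('a \<Rightarrow> 'a) set set" and g
  assume K: "\<forall>S\<in>\<K>. S \<subseteq> Aut \<and>
      (\<forall>g\<in>S. \<exists>B V. group_bounded B \<and> identity_nbhd V \<and> biconv_nbhd g B V \<subseteq> S)"
    and "g \<in> \<Union>\<K>"
  then obtain S where S: "S \<in> \<K>" "g \<in> S"
    by blast
  then obtain B V where "group_bounded B" "identity_nbhd V" "biconv_nbhd g B V \<subseteq> S"
    using K by meson
  with S(1) show "\<exists>B V. group_bounded B \<and> identity_nbhd V \<and> biconv_nbhd g B V \<subseteq> \<Union>\<K>"
    by (meson Union_upper order_trans)
qed auto

lemma openin_lower_topology:
  "openin lower_topology U \<longleftrightarrow> U \<subseteq> Aut \<and>
     (\<forall>g\<in>U. \<exists>B V. group_bounded B \<and> identity_nbhd V \<and> biconv_nbhd g B V \<subseteq> U)"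
  unfolding lower_topology_def topology_inverse'[OF istopology_lower] ..

lemma topspace_lower_topology:
  "topspace lower_topology = (Aut :: ('a::topological_group_add \<Rightarrow> 'a) set)"
proof
  show "topspace lower_topology \<subseteq> (Aut :: ('a \<Rightarrow> 'a) set)"
    using openin_topspace[of "lower_topology :: ('a \<Rightarrow> 'a) topology"]
    unfolding openin_lower_topology by blast
  have "openin lower_topology (Aut :: ('a \<Rightarrow> 'a) set)"
    unfolding openin_lower_topology biconv_nbhd_def
    using group_bounded_empty identity_nbhd_UNIV by blast
  then show "(Aut :: ('a \<Rightarrow> 'a) set) \<subseteq> topspace lower_topology"
    by (rule openin_subset)
qed

lemma biconv_nbhd_contains_open:
  assumes "g \<in> Aut" "group_bounded B" "identity_nbhd V"
  shows "\<exists>U. openin lower_topology U \<and> g \<in> U \<and> U \<subseteq> biconv_nbhd g B V"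
proof -
  define U where "U = {h \<in> Aut. \<exists>W. identity_nbhd W \<and> biconv_nbhd h B W \<subseteq> biconv_nbhd g B V}"
  have "\<exists>C W'. group_bounded C \<and> identity_nbhd W' \<and> biconv_nbhd h C W' \<subseteq> U" if h: "h \<in> U" for h
  proof -
    obtain W where W: "identity_nbhd W" "biconv_nbhd h B W \<subseteq> biconv_nbhd g B V"
      using h unfolding U_def by blast
    obtain W' where W': "identity_nbhd W'" "\<And>x y. x \<in> W' \<Longrightarrow> y \<in> W' \<Longrightarrow> x + y \<in> W"
      using identity_nbhd_half[OF W(1)] by blast
    have "biconv_nbhd k B W' \<subseteq> biconv_nbhd h B W" if "k \<in> biconv_nbhd h B W'" for k
      using that lower_entourage_trans[OF W'(2)] unfolding biconv_nbhd_def by blast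
    then have "biconv_nbhd h B W' \<subseteq> U"
      using W W'(1) unfolding U_def by (auto simp: biconv_nbhd_def[of h B W'] intro!: exI[of _ W'])
    then show ?thesis
      using assms(2) W'(1) by blast
  qed
  then have "openin lower_topology U"
    unfolding openin_lower_topology by (auto simp: U_def)
  moreover have "g \<in> U"
    using assms unfolding U_def by blast
  moreover have "U \<subseteq> biconv_nbhd g B V"
    using biconv_nbhd_self unfolding U_def by blast
  ultimately show ?thesis by blast
qed

text \<open>
  Convergence along an arbitrary filter, hence of arbitrary nets: both \<open>f i \<rightarrow> g\<close> and
  \<open>(f i)\<^sup>-\<^sup>1 \<rightarrow> g\<^sup>-\<^sup>1\<close> uniformly on every bounded set.
\<close>

lemma limitin_lower_topology:
  assumes "\<And>i. f i \<in> Aut" "g \<in> Aut"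
  shows "limitin lower_topology f g F \<longleftrightarrow>
    (\<forall>B. group_bounded B \<longrightarrow> (\<forall>V. identity_nbhd V \<longrightarrow>
       (\<forall>\<^sub>F i in F. \<forall>b\<in>B. (f i b, g b) \<in> lower_entourage V)) \<and>
      (\<forall>V. identity_nbhd V \<longrightarrow>
       (\<forall>\<^sub>F i in F. \<forall>b\<in>B. (inv (f i) b, inv g b) \<in> lower_entourage V)))"
    (is "?L \<longleftrightarrow> ?R")
proof
  assume L: ?L
  have "\<forall>\<^sub>F i in F. f i \<in> biconv_nbhd g B V" if "group_bounded B" "identity_nbhd V" for B V
  proof -
    obtain U where "openin lower_topology U" "g \<in> U" and U: "U \<subseteq> biconv_nbhd g B V"
      using biconv_nbhd_contains_open[OF assms(2) \<open>group_bounded B\<close> \<open>identity_nbhd V\<close>] by blast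
    then have "\<forall>\<^sub>F i in F. f i \<in> U"
      using L unfolding limitin_def by blast
    then show ?thesis
      using U by (auto elim: eventually_mono)
  qed
  then show ?R
    unfolding biconv_nbhd_def by (fastforce elim: eventually_mono)
next
  assume R: ?R
  show ?L
    unfolding limitin_def topspace_lower_topology
  proof (intro conjI allI impI)
    fix U assume "openin lower_topology U \<and> g \<in> U"
    then obtain B V where BV: "group_bounded B" "identity_nbhd V" "biconv_nbhd g B V \<subseteq> U"
      unfolding openin_lower_topology by blast
    have "\<forall>\<^sub>F i in F. \<forall>b\<in>B. (f i b, g b) \<in> lower_entourage V"
      and "\<forall>\<^sub>F i in F. \<forall>b\<in>B. (inv (f i) b, inv g b) \<in> lower_entourage V"
      using R BV by blast+
    then show "\<forall>\<^sub>F i in F. f i \<in> U"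
    proof eventually_elim
      case (elim i)
      then have "f i \<in> biconv_nbhd g B V"
        using assms(1) unfolding biconv_nbhd_def by blast
      then show ?case using BV(3) by blast
    qed
  qed (rule assms)
qed

lemma conjugation_0: "conjugation 0 = id"
  by (simp add: fun_eq_iff conjugation_def)

lemma conjugation_add: "conjugation (x + y) = conjugation x \<circ> conjugation y"
proof
  fix z
  have "x + y + z - (x + y) = x + y + z + (- y + - x)"
    by (simp only: diff_conv_add_uminus minus_add)
  also have "\<dots> = x + (y + z - y) - x"
    by (simp only: diff_conv_add_uminus add.assoc)
  finally show "conjugation (x + y) z = (conjugation x \<circ> conjugation y) z"
    by (simp only: conjugation_def o_apply)
qed

lemma conjugation_inverse:
  "conjugation x \<circ> conjugation (- x) = id" "conjugation (- x) \<circ> conjugation x = id"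
  by (simp_all add: conjugation_add[symmetric] conjugation_0)

lemma inv_conjugation: "inv (conjugation x) = conjugation (- x)"
  by (rule inv_unique_comp) (rule conjugation_inverse)+

lemma conjugation_in_Aut: "conjugation (x :: 'a::topological_group_add) \<in> Aut"
proof -
  have "bij (conjugation x)"
    using o_bij conjugation_inverse by blast
  moreover have "conjugation x (y + z) = conjugation x y + conjugation x z" for y z
  proof -
    have "x + y - x + (x + z - x) = x + (y + (- x + (x + (z + - x))))"
      by (simp only: diff_conv_add_uminus add.assoc)
    also have "\<dots> = x + (y + z) - x"
      by (simp only: minus_add_cancel diff_conv_add_uminus add.assoc)
    finally show ?thesis
      by (simp only: conjugation_def)
  qed
  moreover have "continuous_on UNIV (conjugation z)" for z :: 'a
    unfolding conjugation_def[abs_def] diff_conv_add_uminus by (intro continuous_intros)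
  ultimately show ?thesis
    unfolding Aut_def by (simp add: inv_conjugation)
qed

end

theory Submission
  imports Defs
begin

text \<open>
  Write a point near \<open>x\<close> both as \<open>u + x\<close> and as \<open>x + w\<close>, with \<open>u\<close> and \<open>w\<close> small. Conjugation by \<open>u + x\<close>
  sends \<open>b\<close> to \<open>u + (x + b - x) - u\<close>, and conjugation by \<open>-(x + w)\<close> sends it to
  \<open>- w + (- x + b + x) + w\<close>. In both cases the value at \<open>x\<close> is only multiplied on the left and on the
  right by small elements, and this is exactly closeness in the lower uniform structure (\<open>conjugation_lower_entourage\<close>). How small
  \<open>u\<close> and \<open>w\<close> have to be depends on the entourage but not on \<open>b\<close>, so near \<open>x\<close>
  the conjugations and their inverses converge uniformly on the whole group
  (\<open>eventually_conjugation_lower_entourage\<close>), hence on each bounded set.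
\<close>

lemma eventually_identity_nbhd:
  assumes "identity_nbhd V" "(f \<longlongrightarrow> 0) F"
  shows "\<forall>\<^sub>F i in F. f i \<in> V"
proof -
  have "\<forall>\<^sub>F i in F. f i \<in> interior V"
    using topological_tendstoD[OF assms(2) open_interior] assms(1)
    by (simp add: identity_nbhd_def)
  then show ?thesis
    by (rule eventually_mono) (use interior_subset in blast)
qed

text \<open>
  Replacing \<open>x\<close> by \<open>y = (y - x) + x\<close> conjugates the value once more by \<open>y - x\<close>, so the entourage
  condition comes down to two memberships that do not mention the argument \<open>b\<close>: this is the source
  of the uniformity.
\<close>

lemma conjugation_lower_entourage:
  assumes "y - x \<in> V" "x - y \<in> V"
  shows "(conjugation y b, conjugation x b) \<in> lower_entourage V"
proof -
  have "conjugation y b = conjugation (y - x) (conjugation x b)"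
    using conjugation_add[of "y - x" x] by simp
  then have "conjugation y b = (y - x) + conjugation x b + (x - y)"
    by (simp only: conjugation_def[of "y - x"] diff_conv_add_uminus[of _ "y - x"] minus_diff_eq)
  then show ?thesis
    using assms unfolding lower_entourage_def by blast
qed

text \<open>
  Stated for an arbitrary filter because it serves twice: for \<open>f \<rightarrow> x\<close>, and for \<open>- f \<rightarrow> - x\<close>, which
  gives the convergence of the inverse automorphisms.
\<close>

lemma eventually_conjugation_lower_entourage:
  assumes "identity_nbhd V" "(f \<longlongrightarrow> x) F"
  shows "\<forall>\<^sub>F i in F. \<forall>b. (conjugation (f i) b, conjugation x b) \<in> lower_entourage V"
proof -
  have "((\<lambda>i. f i + - x) \<longlongrightarrow> x + - x) F" "((\<lambda>i. x + - f i) \<longlongrightarrow> x + - x) F"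
    by (intro tendsto_add tendsto_minus tendsto_const assms(2))+
  then have "\<forall>\<^sub>F i in F. f i - x \<in> V" "\<forall>\<^sub>F i in F. x - f i \<in> V"
    using eventually_identity_nbhd[OF assms(1)] by simp_all
  then show ?thesis
    by eventually_elim (simp add: conjugation_lower_entourage)
qed

theorem proposition3p9:
  assumes "locally_bounded_group TYPE('a::topological_group_add)"
  shows "continuous_map euclidean lower_topology (conjugation :: 'a \<Rightarrow> 'a \<Rightarrow> 'a)"
proof -
  have "limitin lower_topology conjugation (conjugation x) (at x)" for x :: 'a
  proof -
    have id: "((\<lambda>y. y) \<longlongrightarrow> x) (at x)" and minus: "((\<lambda>y. - y) \<longlongrightarrow> - x) (at x)"
      by (intro tendsto_intros)+
    show ?thesis
      unfolding limitin_lower_topology[OF conjugation_in_Aut conjugation_in_Aut] inv_conjugation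
      by (intro allI impI conjI;
          rule eventually_mono[OF eventually_conjugation_lower_entourage[OF _ id]]
            eventually_mono[OF eventually_conjugation_lower_entourage[OF _ minus]]; blast)
  qed
  moreover have "atin euclidean x = at x" for x :: 'a
    by (simp add: atin_def nhdsin_def nhds_def at_within_def)
  ultimately show ?thesis
    by (simp add: continuous_map_atin)
qed

end
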